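(* Let $n\geq 2$ and let $R$ be a connected quantized Weyl algebra over $\mathbb{K}$ generated by $x_1,\dots,x_n$ with parameters $q_{ij}$, $r_{ij}$, and let $q\in\mathbb{K}^*$ be such that $\{q_{ij}:1\leq i\neq j\leq n\}=\{q,q^{-1}\}$. Suppose that $q\neq\pm 1$. Then $R\simeq L_n^q$ or $R\simeq C_n^q$ as $\mathbb{K}$-algebras (the latter being possible only when $n$ is odd, since $C_n^q$ is defined only for odd $n$).
   Context: $\mathbb{K}$ is an algebraically closed field, $\mathbb{K}^*=\mathbb{K}\setminus\{0\}$. A connected quantized Weyl algebra over $\mathbb{K}$ is an associative unital $\mathbb{K}$-algebra $R$ with generators $x_1,\dots,x_n$, $n\geq 2$, such that: (i) there are scalars $q_{ij}\in\mathbb{K}^*$ and $r_{ij}\in\mathbb{K}$, $1\leq i\neq j\leq n$, with $q_{ji}=q_{ij}^{-1}$ and $r_{ji}=-q_{ij}^{-1}r_{ij}$, such that $x_ix_j=q_{ij}x_jx_i+r_{ij}$ for all $i\neq j$; (ii) the standard monomials $x_1^{a_1}\cdots x_n^{a_n}$ form a $\mathbb{K}$-basis of $R$; (iii) the graph with vertices $x_1,\dots,x_n$, with an edge between $x_i$ and $x_j$ if and only if $r_{ij}\neq 0$, is connected. For such an algebra there always exists $q\in\mathbb{K}^*$ with $\{q_{ij}\}=\{q,q^{-1}\}$. For $n\geq 1$ and $q\in\mathbb{K}^*\setminus\{1\}$, $L_n^q$ is the $\mathbb{K}$-algebra generated by $x_1,\dots,x_n$ subject to the relations: $x_ix_{i+1}-qx_{i+1}x_i=1-q$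 for $1\leq i\leq n-1$; $x_ix_j=qx_jx_i$ for $1\leq i$, $i+1<j\leq n$, $j-i$ odd; $x_ix_j=q^{-1}x_jx_i$ for $1\leq i$, $i+1<j\leq n$, $j-i$ even. For $n$ odd and $q\in\mathbb{K}^*$, $C_n^q$ is the $\mathbb{K}$-algebra generated by $x_1,\dots,x_n$ subject to the same relations except that the relation $x_1x_n=q^{-1}x_nx_1$ is replaced by $x_nx_1-qx_1x_n=1-q$; that is: $x_ix_{i+1}-qx_{i+1}x_i=1-q$ for $1\leq i\leq n-1$; $x_nx_1-qx_1x_n=1-q$; $x_ix_j=qx_jx_i$ for $i+1<j\leq n$, $j-i$ odd; $x_ix_j=q^{-1}x_jx_i$ for $i+1<j\leq n$, $j-i$ even, $(i,j)\neq(1,n)$. *)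

theory Defs
  imports
    "HOL-Algebra.QuotRing"
    "HOL-Algebra.Module"
    "HOL-Computational_Algebra.Polynomial"
    "HOL-Library.Poly_Mapping"
begin

section \<open>Associative unital algebras and connected quantized Weyl algebras\<close>

locale unital_algebra = vector_space scale
  for scale :: "'k::field \<Rightarrow> 'r::ring_1 \<Rightarrow> 'r" +
  assumes scale_mult_left: "scale c x * y = scale c (x * y)"
    and scale_mult_right: "x * scale c y = scale c (x * y)"

inductive_set generated_subalgebra :: "('k \<Rightarrow> 'r::ring_1 \<Rightarrow> 'r) \<Rightarrow> 'r set \<Rightarrow> 'r set"
  for scale X where
  gen: "x \<in> X \<Longrightarrow> x \<in> generated_subalgebra scale X"
| one: "1 \<in> generated_subalgebra scale X"
| add: "x \<in> generated_subalgebra scale X \<Longrightarrow> y \<in> generated_subalgebra scale X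
          \<Longrightarrow> x + y \<in> generated_subalgebra scale X"
| mult: "x \<in> generated_subalgebra scale X \<Longrightarrow> y \<in> generated_subalgebra scale X
          \<Longrightarrow> x * y \<in> generated_subalgebra scale X"
| scale: "x \<in> generated_subalgebra scale X \<Longrightarrow> scale c x \<in> generated_subalgebra scale X"

definition exponents :: "nat \<Rightarrow> (nat \<Rightarrow> nat) set" where
  "exponents n = {1..n} \<rightarrow>\<^sub>E UNIV"

definition standard_monomial :: "nat \<Rightarrow> (nat \<Rightarrow> 'r::ring_1) \<Rightarrow> (nat \<Rightarrow> nat) \<Rightarrow> 'r" where
  "standard_monomial n x a = prod_list (map (\<lambda>i. x i ^ a i) [1..<Suc n])"

definition edges :: "nat \<Rightarrow> (nat \<Rightarrow> nat \<Rightarrow> 'k::field) \<Rightarrow> (nat \<times> nat) set" where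
  "edges n r = {(i, j). i \<in> {1..n} \<and> j \<in> {1..n} \<and> i \<noteq> j \<and> r i j \<noteq> 0}"

text \<open>The values of the functions \<open>x\<close>, \<open>q\<close> and \<open>r\<close> matter only at indices in \<open>{1..n}\<close>, and those of \<open>q\<close>
  and \<open>r\<close> only off the diagonal. The standard monomials are a basis as a family indexed by
  exponents, whence the injectivity condition.\<close>

locale connected_quantized_weyl_algebra = unital_algebra scale
  for scale :: "'k::field \<Rightarrow> 'r::ring_1 \<Rightarrow> 'r" +
  fixes n :: nat and x :: "nat \<Rightarrow> 'r" and q r :: "nat \<Rightarrow> nat \<Rightarrow> 'k"
  assumes n_ge_2: "n \<ge> 2"
    and generators: "generated_subalgebra scale (x ` {1..n}) = UNIV"
    and q_nonzero: "\<lbrakk>i \<in> {1..n}; j \<in> {1..n}; i \<noteq> j\<rbrakk> \<Longrightarrow> q i j \<noteq> 0"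
    and q_swap: "\<lbrakk>i \<in> {1..n}; j \<in> {1..n}; i \<noteq> j\<rbrakk> \<Longrightarrow> q j i = inverse (q i j)"
    and r_swap: "\<lbrakk>i \<in> {1..n}; j \<in> {1..n}; i \<noteq> j\<rbrakk> \<Longrightarrow> r j i = - inverse (q i j) * r i j"
    and relations: "\<lbrakk>i \<in> {1..n}; j \<in> {1..n}; i \<noteq> j\<rbrakk>
          \<Longrightarrow> x i * x j = scale (q i j) (x j * x i) + scale (r i j) 1"
    and monomials_inj: "inj_on (standard_monomial n x) (exponents n)"
    and monomials_independent: "independent (standard_monomial n x ` exponents n)"
    and monomials_span: "span (standard_monomial n x ` exponents n) = UNIV"
    and connected_graph: "\<lbrakk>i \<in> {1..n}; j \<in> {1..n}\<rbrakk> \<Longrightarrow> (i, j) \<in> (edges n r)\<^sup>*"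

section \<open>Algebras as records, quotients and isomorphisms\<close>

text \<open>Algebras whose underlying set is not a whole type are records of type
  \<^typ>\<open>('k, 'a) module\<close>, whose ring operations together with the scalar multiplication are the
  structure of an algebra over the field \<^typ>\<open>'k\<close>.\<close>

definition algebra_of_type :: "('k \<Rightarrow> 'r::ring_1 \<Rightarrow> 'r) \<Rightarrow> ('k, 'r) module" where
  "algebra_of_type scale =
     \<lparr>carrier = UNIV, monoid.mult = (*), one = 1, ring.zero = 0, add = (+), module.smult = scale\<rparr>"

definition quotient_algebra :: "('k, 'a) module \<Rightarrow> 'a set \<Rightarrow> ('k, 'a set) module" where
  "quotient_algebra A I =
     ring.extend (A Quot I) (module.fields (\<lambda>c C. \<Union>a\<in>C. I +>\<^bsub>A\<^esub> (c \<odot>\<^bsub>A\<^esub> a)))"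

definition algebra_isomorphic :: "('k, 'a) module \<Rightarrow> ('k, 'b) module \<Rightarrow> bool"
    (infix \<open>\<simeq>\<^sub>a\<^sub>l\<^sub>g\<close> 50) where
  "A \<simeq>\<^sub>a\<^sub>l\<^sub>g B \<longleftrightarrow>
     (\<exists>h \<in> ring_iso A B. \<forall>c. \<forall>a \<in> carrier A. h (c \<odot>\<^bsub>A\<^esub> a) = c \<odot>\<^bsub>B\<^esub> h a)"

section \<open>Free algebras and presentations\<close>

text \<open>Words under concatenation, written additively so that \<^typ>\<open>'v list \<Rightarrow>\<^sub>0 'k\<close> is the
  monoid algebra of words, its multiplication being convolution.\<close>

instantiation list :: (type) monoid_add
begin

definition zero_list :: "'a list" where "0 = []"

definition plus_list :: "'a list \<Rightarrow> 'a list \<Rightarrow> 'a list" where "xs + ys = xs @ ys"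

instance by standard (simp_all add: zero_list_def plus_list_def)

end

definition var :: "'v \<Rightarrow> 'v list \<Rightarrow>\<^sub>0 'k::field" where
  "var v = Poly_Mapping.single [v] 1"

definition const :: "'k::field \<Rightarrow> 'v list \<Rightarrow>\<^sub>0 'k" where
  "const c = Poly_Mapping.single [] c"

definition free_algebra :: "'v set \<Rightarrow> ('k::field, 'v list \<Rightarrow>\<^sub>0 'k) module" where
  "free_algebra V =
     \<lparr>carrier = {p. Poly_Mapping.keys p \<subseteq> lists V}, monoid.mult = (*), one = 1,
      ring.zero = 0, add = (+), module.smult = (\<lambda>c p. const c * p)\<rparr>"

text \<open>The relators in \<open>S\<close> are the elements that become zero; \<open>Idl\<close> is the two-sided ideal
  they generate.\<close>

definition presented_algebra ::
    "'v set \<Rightarrow> ('v list \<Rightarrow>\<^sub>0 'k::field) set \<Rightarrow> ('k, ('v list \<Rightarrow>\<^sub>0 'k) set) module" where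
  "presented_algebra V S = quotient_algebra (free_algebra V) (Idl\<^bsub>free_algebra V\<^esub> S)"

section \<open>The algebras \<open>L\<close> and \<open>C\<close>\<close>

definition L_relators :: "nat \<Rightarrow> 'k::field \<Rightarrow> (nat list \<Rightarrow>\<^sub>0 'k) set" where
  "L_relators n q =
     {var i * var (i + 1) - const q * (var (i + 1) * var i) - const (1 - q) | i.
        1 \<le> i \<and> i + 1 \<le> n}
   \<union> {var i * var j - const q * (var j * var i) | i j.
        1 \<le> i \<and> i + 1 < j \<and> j \<le> n \<and> odd (j - i)}
   \<union> {var i * var j - const (inverse q) * (var j * var i) | i j.
        1 \<le> i \<and> i + 1 < j \<and> j \<le> n \<and> even (j - i)}"

definition C_relators :: "nat \<Rightarrow> 'k::field \<Rightarrow> (nat list \<Rightarrow>\<^sub>0 'k) set" where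
  "C_relators n q =
     {var i * var (i + 1) - const q * (var (i + 1) * var i) - const (1 - q) | i.
        1 \<le> i \<and> i + 1 \<le> n}
   \<union> {var n * var 1 - const q * (var 1 * var n) - const (1 - q)}
   \<union> {var i * var j - const q * (var j * var i) | i j.
        1 \<le> i \<and> i + 1 < j \<and> j \<le> n \<and> odd (j - i)}
   \<union> {var i * var j - const (inverse q) * (var j * var i) | i j.
        1 \<le> i \<and> i + 1 < j \<and> j \<le> n \<and> even (j - i) \<and> (i, j) \<noteq> (1, n)}"

definition L_algebra :: "nat \<Rightarrow> 'k::field \<Rightarrow> ('k, (nat list \<Rightarrow>\<^sub>0 'k) set) module" where
  "L_algebra n q = presented_algebra {1..n} (L_relators n q)"

text \<open>This is the algebra intended only when \<open>n\<close> is odd.\<close>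

definition C_algebra :: "nat \<Rightarrow> 'k::field \<Rightarrow> ('k, (nat list \<Rightarrow>\<^sub>0 'k) set) module" where
  "C_algebra n q = presented_algebra {1..n} (C_relators n q)"

end

theory Submission
  imports Defs
begin

text \<open>Equating the two ways of reordering \<open>x\<^sub>i x\<^sub>j x\<^sub>k\<close> shows that \<open>q\<^sub>i\<^sub>j q\<^sub>i\<^sub>k = 1\<close> whenever
  \<open>r\<^sub>j\<^sub>k \<noteq> 0\<close>. Direct each edge \<open>{i, j}\<close> of the graph from \<open>i\<close> to \<open>j\<close> if \<open>q\<^sub>i\<^sub>j = q\<close>. As \<open>q\<^sup>2 \<noteq> 1\<close>,
  in- and out-degrees are at most one, so that the connected graph is a directed path or a directed
  cycle. Along it, the same identity forces the remaining \<open>q\<^sub>i\<^sub>j\<close> to alternate between \<open>q\<close> and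
  \<open>q\<^sup>-\<^sup>1\<close>, and a cycle must have odd length. Rescaling the generators (for a cycle by means of a square
  root) turns every non-zero \<open>r\<^sub>i\<^sub>j\<close> along the path into \<open>1 - q\<close>, so \<open>R\<close> is the image of
  \<open>L\<^sub>n\<close> or \<open>C\<^sub>n\<close> under a homomorphism. It is injective since the defining
  relations turn any word into a linear combination of words sorted in the original order of the \<open>x\<^sub>i\<close>, whose images form a basis
  of \<open>R\<close> up to non-zero scalars.\<close>

section \<open>Free algebras\<close>

text \<open>Finite support writes \<open>p\<close> as a finite sum of single terms. With
  \<open>A\<close> equal to \<open>lists V\<close> this is induction inside the free algebra on
  \<open>V\<close>.\<close>

lemma poly_mapping_keys_induct [consumes 1, case_names zero add single]:
  fixes p :: "'a \<Rightarrow>\<^sub>0 'b::comm_monoid_add"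
  assumes keys: "Poly_Mapping.keys p \<subseteq> A"
    and zero: "P 0"
    and add: "\<And>p q. P p \<Longrightarrow> P q \<Longrightarrow> P (p + q)"
    and single: "\<And>w c. w \<in> A \<Longrightarrow> P (Poly_Mapping.single w c)"
  shows "P p"
proof -
  have "P (\<Sum>w\<in>F. Poly_Mapping.single w (f w))" if "F \<subseteq> A" "finite F" for F f
    using that(2,1) by (induction F) (simp_all add: zero add single)
  moreover have "p = (\<Sum>w\<in>Poly_Mapping.keys p. Poly_Mapping.single w (Poly_Mapping.lookup p w))"
    by (rule poly_mapping_eqI)
      (auto simp: lookup_sum lookup_single when_def in_keys_iff)
  ultimately show ?thesis
    using keys finite_keys[of p] by metis
qed

lemma const_single: "const c * Poly_Mapping.single w d = Poly_Mapping.single w (c * d)"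
  unfolding const_def mult_single by (simp add: plus_list_def)

lemma single_const: "Poly_Mapping.single w d * const c = Poly_Mapping.single w (c * d)"
  unfolding const_def mult_single by (simp add: plus_list_def mult.commute)

lemma const_commute: "const c * p = p * const c"
  by (rule poly_mapping_keys_induct[of p UNIV])
    (simp_all add: distrib_left distrib_right const_single single_const)

lemma var_const_left_commute: "var i * (const c * r) = const c * (var i * r)"
  by (metis const_commute mult.assoc)

lemma const_add: "const (a + b) = const a + const b"
  by (simp add: const_def single_add)

lemma const_mult: "const (a * b) = const a * const b"
  by (simp add: const_def mult_single plus_list_def)

lemma const_0 [simp]: "const 0 = 0"
  by (simp add: const_def)

lemma const_1 [simp]: "const 1 = 1"
  by (simp add: const_def zero_list_def flip: single_one)

lemma const_uminus: "const (- a) = - const a"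
  by (simp add: const_def single_uminus)

lemma single_Cons: "Poly_Mapping.single (i # w) c = var i * Poly_Mapping.single w c"
  by (simp add: var_def mult_single plus_list_def)

lemma keys_var [simp]: "Poly_Mapping.keys (var v :: 'v list \<Rightarrow>\<^sub>0 'k::field) = {[v]}"
  by (simp add: var_def)

lemma keys_const [simp]: "Poly_Mapping.keys (const c) \<subseteq> lists V"
  by (simp add: const_def)

text \<open>Scalars act through multiplication by constants. This supplies
  \<open>free_algebra.span\<close>, with which reordering modulo an ideal is expressed.\<close>

global_interpretation free_algebra: vector_space "\<lambda>c p. const c * (p :: 'v list \<Rightarrow>\<^sub>0 'k::field)"
  by unfold_locales
    (simp_all add: distrib_left distrib_right const_add const_mult mult.assoc)

lemma free_algebra_simps [simp]:
  "carrier (free_algebra V) = {p. Poly_Mapping.keys p \<subseteq> lists V}"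
  "monoid.mult (free_algebra V) = (*)" "monoid.one (free_algebra V) = 1"
  "ring.zero (free_algebra V) = 0" "ring.add (free_algebra V) = (+)"
  "module.smult (free_algebra V) = (\<lambda>c p. const c * p)"
  by (simp_all add: free_algebra_def)

lemma keys_mult_lists:
  assumes "Poly_Mapping.keys p \<subseteq> lists V" "Poly_Mapping.keys q \<subseteq> lists V"
  shows "Poly_Mapping.keys (p * q) \<subseteq> lists V"
proof
  fix w assume "w \<in> Poly_Mapping.keys (p * q)"
  then obtain u v where "u \<in> Poly_Mapping.keys p" "v \<in> Poly_Mapping.keys q" "w = u + v"
    using keys_mult[of p q] by blast
  then show "w \<in> lists V"
    using assms by (auto simp: plus_list_def)
qed

lemma ring_free_algebra: "ring (free_algebra V :: ('k::field, 'v list \<Rightarrow>\<^sub>0 'k) module)"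
  (is "ring ?A")
proof (rule ringI)
  show "abelian_group ?A"
  proof (rule abelian_groupI)
    fix p assume "p \<in> carrier ?A"
    then show "\<exists>r\<in>carrier ?A. r \<oplus>\<^bsub>?A\<^esub> p = \<zero>\<^bsub>?A\<^esub>"
      by (intro bexI[of _ "- p"]) simp_all
  qed (auto simp: add.assoc add.commute dest!: subsetD[OF keys_add])
  show "Group.monoid ?A"
    by (rule monoidI) (simp_all add: keys_mult_lists mult.assoc zero_list_def)
qed (simp_all add: distrib_left distrib_right)

lemma algebra_of_type_simps [simp]:
  "carrier (algebra_of_type scale) = UNIV"
  "monoid.mult (algebra_of_type scale) = (*)" "monoid.one (algebra_of_type scale) = 1"
  "ring.zero (algebra_of_type scale) = 0" "ring.add (algebra_of_type scale) = (+)"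
  "module.smult (algebra_of_type scale) = scale"
  by (simp_all add: algebra_of_type_def)

lemma ring_algebra_of_type: "ring (algebra_of_type scale)"
proof (rule ringI)
  show "abelian_group (algebra_of_type scale)"
  proof (rule abelian_groupI)
    fix x show "\<exists>y\<in>carrier (algebra_of_type scale).
        y \<oplus>\<^bsub>algebra_of_type scale\<^esub> x = \<zero>\<^bsub>algebra_of_type scale\<^esub>"
      by (intro bexI[of _ "- x"]) (simp_all)
  qed (simp_all add: add.assoc add.commute)
  show "Group.monoid (algebra_of_type scale)"
    by (rule monoidI) (simp_all add: mult.assoc)
qed (simp_all add: distrib_left distrib_right)

section \<open>Evaluation of noncommutative polynomials in an algebra\<close>

context unital_algebra
begin

text \<open>This is the unital algebra homomorphism from the free algebra that sends
  \<open>var i\<close> to \<open>y i\<close>.\<close>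

definition evaluate :: "('v \<Rightarrow> 'r) \<Rightarrow> ('v list \<Rightarrow>\<^sub>0 'k) \<Rightarrow> 'r" where
  "evaluate y p =
     (\<Sum>w\<in>Poly_Mapping.keys p. scale (Poly_Mapping.lookup p w) (prod_list (map y w)))"

text \<open>Zero coefficients contribute nothing, so polynomials with different supports can be
  summed over one common index set.\<close>

lemma evaluate_eq_sum:
  assumes "finite F" "Poly_Mapping.keys p \<subseteq> F"
  shows "evaluate y p = (\<Sum>w\<in>F. scale (Poly_Mapping.lookup p w) (prod_list (map y w)))"
  unfolding evaluate_def
  using assms by (intro sum.mono_neutral_left) (auto simp: in_keys_iff)

lemma evaluate_add: "evaluate y (p + r) = evaluate y p + evaluate y r"
proof -
  let ?F = "Poly_Mapping.keys p \<union> Poly_Mapping.keys r"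
  have "Poly_Mapping.keys (p + r) \<subseteq> ?F"
    by (rule keys_add)
  then show ?thesis
    by (simp add: evaluate_eq_sum[of ?F] lookup_add scale_left_distrib sum.distrib)
qed

lemma evaluate_0 [simp]: "evaluate y 0 = 0"
  by (simp add: evaluate_def)

lemma evaluate_uminus: "evaluate y (- p) = - evaluate y p"
  using evaluate_add[of y p "- p"] by (simp add: eq_neg_iff_add_eq_0 add.commute)

lemma evaluate_diff: "evaluate y (p - r) = evaluate y p - evaluate y r"
  using evaluate_add[of y p "- r"] by (simp add: evaluate_uminus)

lemma evaluate_single: "evaluate y (Poly_Mapping.single w c) = scale c (prod_list (map y w))"
  by (simp add: evaluate_def)

lemma evaluate_var [simp]: "evaluate y (var i) = y i"
  by (simp add: var_def evaluate_single)

lemma evaluate_const: "evaluate y (const c) = scale c 1"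
  by (simp add: const_def evaluate_single)

lemma evaluate_1 [simp]: "evaluate y 1 = 1"
  using evaluate_const[of y 1] by simp

text \<open>Both sides are bilinear, so single words suffice; for these, concatenation becomes the
  product in the algebra.\<close>

lemma evaluate_mult: "evaluate y (p * r) = evaluate y p * evaluate y r"
proof (rule poly_mapping_keys_induct[of p UNIV])
  fix u c
  show "evaluate y (Poly_Mapping.single u c * r) = evaluate y (Poly_Mapping.single u c) * evaluate y r"
    by (rule poly_mapping_keys_induct[of r UNIV])
      (simp_all add: distrib_left evaluate_add mult_single plus_list_def evaluate_single
        scale_mult_left scale_mult_right)
qed (simp_all add: distrib_right evaluate_add)

lemma evaluate_const_mult: "evaluate y (const c * p) = scale c (evaluate y p)"
  by (simp add: evaluate_mult evaluate_const scale_mult_left)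

lemma evaluate_ring_hom_ring:
  "ring_hom_ring (free_algebra V) (algebra_of_type scale) (evaluate y)"
  by (rule ring_hom_ringI[OF ring_free_algebra ring_algebra_of_type])
    (simp_all add: evaluate_mult evaluate_add)

lemma evaluate_image_free_algebra:
  fixes y :: "'v \<Rightarrow> 'r"
  assumes "generated_subalgebra scale (y ` V) = UNIV"
  shows "evaluate y ` carrier (free_algebra V) = UNIV"
proof -
  interpret ring "free_algebra V :: ('k, 'v list \<Rightarrow>\<^sub>0 'k) module"
    by (rule ring_free_algebra)
  have "x \<in> evaluate y ` carrier (free_algebra V)" if "x \<in> generated_subalgebra scale (y ` V)" for x
    using that
  proof (induction rule: generated_subalgebra.induct)
    case (gen x)
    then obtain i where "i \<in> V" "x = y i" by blast
    then show ?case
      by (intro image_eqI[of _ _ "var i"]) simp_all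
  next
    case one
    then show ?case
      using one_closed by (intro image_eqI[of _ _ 1]) simp_all
  next
    case (add x y')
    then obtain p r where "p \<in> carrier (free_algebra V)" "r \<in> carrier (free_algebra V)"
      "x = evaluate y p" "y' = evaluate y r" by blast
    then show ?case
      using a_closed[of p r] by (intro image_eqI[of _ _ "p + r"]) (simp_all add: evaluate_add)
  next
    case (mult x y')
    then obtain p r where "p \<in> carrier (free_algebra V)" "r \<in> carrier (free_algebra V)"
      "x = evaluate y p" "y' = evaluate y r" by blast
    then show ?case
      using m_closed[of p r] by (intro image_eqI[of _ _ "p * r"]) (simp_all add: evaluate_mult)
  next
    case (scale x c)
    then obtain p where p: "p \<in> carrier (free_algebra V)" "x = evaluate y p" by blast
    moreover have "const c \<in> carrier (free_algebra V)"
      by simp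
    ultimately show ?case
      using m_closed[of "const c" p]
      by (intro image_eqI[of _ _ "const c * p"]) (simp_all add: evaluate_const_mult)
  qed
  with assms show ?thesis by blast
qed

end

section \<open>Presentations with exchange relations\<close>

abbreviation word :: "'v list \<Rightarrow> 'v list \<Rightarrow>\<^sub>0 'k::field" where
  "word w \<equiv> Poly_Mapping.single w 1"

section \<open>Straightening words modulo an ideal\<close>

context
  fixes V :: "'v set" and f :: "'v \<Rightarrow> 'o::linorder" and I :: "('v list \<Rightarrow>\<^sub>0 'k::field) set"
  assumes ideal: "ideal I (free_algebra V)"
    and exchange: "\<And>i j. \<lbrakk>i \<in> V; j \<in> V; f j < f i\<rbrakk>
      \<Longrightarrow> \<exists>a b. var i * var j - const a * (var j * var i) - const b \<in> I"
begin

lemma ideal_closed: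
  "0 \<in> I"
  "p \<in> I \<Longrightarrow> r \<in> I \<Longrightarrow> p + r \<in> I"
  "p \<in> I \<Longrightarrow> Poly_Mapping.keys r \<subseteq> lists V \<Longrightarrow> r * p \<in> I"
  "p \<in> I \<Longrightarrow> Poly_Mapping.keys r \<subseteq> lists V \<Longrightarrow> p * r \<in> I"
  "p \<in> I \<Longrightarrow> const c * p \<in> I"
proof -
  interpret ideal I "free_algebra V" by (rule ideal)
  show "0 \<in> I" "p \<in> I \<Longrightarrow> r \<in> I \<Longrightarrow> p + r \<in> I"
    using additive_subgroup.zero_closed[OF is_additive_subgroup]
      additive_subgroup.a_closed[OF is_additive_subgroup, of p r] by simp_all
  show "p \<in> I \<Longrightarrow> Poly_Mapping.keys r \<subseteq> lists V \<Longrightarrow> r * p \<in> I"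
    and "p \<in> I \<Longrightarrow> Poly_Mapping.keys r \<subseteq> lists V \<Longrightarrow> p * r \<in> I" for r
    using I_l_closed[of p r] I_r_closed[of p r] by simp_all
  then show "p \<in> I \<Longrightarrow> const c * p \<in> I"
    by simp
qed

text \<open>Polynomials of degree below \<open>m\<close> modulo \<open>I\<close>: the lower-order
  errors left behind by reordering. Having \<open>I\<close> in the spanning set avoids computing
  with cosets.\<close>

definition short_words :: "nat \<Rightarrow> ('v list \<Rightarrow>\<^sub>0 'k) set" where
  "short_words m = free_algebra.span (I \<union> {word w | w. w \<in> lists V \<and> length w < m})"

lemma short_words_ideal: "p \<in> I \<Longrightarrow> p \<in> short_words m"
  unfolding short_words_def by (blast intro: free_algebra.span_base)

lemma short_words_word: "w \<in> lists V \<Longrightarrow> length w < m \<Longrightarrow> word w \<in> short_words m"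
  unfolding short_words_def by (blast intro: free_algebra.span_base)

lemma short_words_add: "p \<in> short_words m \<Longrightarrow> r \<in> short_words m \<Longrightarrow> p + r \<in> short_words m"
  unfolding short_words_def by (rule free_algebra.span_add)

lemma short_words_scale: "p \<in> short_words m \<Longrightarrow> const c * p \<in> short_words m"
  unfolding short_words_def by (rule free_algebra.span_scale)

text \<open>Multiplication by a generator preserves \<open>I\<close> and lengthens a word by one
  letter; linearity does the rest.\<close>

lemma short_words_var_mult:
  assumes "i \<in> V" "p \<in> short_words m"
  shows "var i * p \<in> short_words (Suc m)"
  using assms(2) unfolding short_words_def
proof (induction rule: free_algebra.span_induct_alt)
  case base
  then show ?case by (simp add: free_algebra.span_zero)
next
  case (step c p r)
  have "var i * p \<in> short_words (Suc m)"
    using step(1)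
  proof
    assume "p \<in> I"
    then show ?thesis
      using assms(1) by (intro short_words_ideal ideal_closed(3)) auto
  next
    assume "p \<in> {word w | w. w \<in> lists V \<and> length w < m}"
    then show ?thesis
      using assms(1) by (auto simp flip: single_Cons intro!: short_words_word)
  qed
  then show ?case
    using step(2)
    by (auto simp: distrib_left var_const_left_commute simp flip: short_words_def
        intro!: short_words_add short_words_scale)
qed

text \<open>Induction moves \<open>i\<close> to the right one letter at a time. Each exchange costs
  a scalar and a term that is two letters shorter, which counts as an error.\<close>

lemma word_Cons_insort:
  assumes "i \<in> V" "w \<in> lists V"
  shows "\<exists>a. word (i # w) - const a * word (insort_key f i w) \<in> short_words (Suc (length w))"
  using assms(2)
proof (induction w)
  case Nil
  show ?case
    by (intro exI[of _ 1]) (simp add: short_words_ideal ideal_closed(1))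
next
  case (Cons j w)
  show ?case
  proof (cases "f i \<le> f j")
    case True
    then show ?thesis
      by (intro exI[of _ 1]) (simp add: short_words_ideal ideal_closed(1))
  next
    case False
    then obtain a b where ab: "var i * var j - const a * (var j * var i) - const b \<in> I"
      using exchange[of i j] assms(1) Cons.hyps by (auto simp: not_le)
    obtain c where c: "word (i # w) - const c * word (insort_key f i w) \<in> short_words (Suc (length w))"
      using Cons.IH by blast
    \<comment> \<open>The error splits into the exchange relator times \<open>word w\<close>, the
      error of the shorter insertion preceded by \<open>j\<close>, and the constant of the
      exchange.\<close>
    have "word (i # j # w) - const (a * c) * word (j # insort_key f i w) =
        (var i * var j - const a * (var j * var i) - const b) * word w
        + const a * (var j * (word (i # w) - const c * word (insort_key f i w)))
        + const b * word w"
      by (simp add: single_Cons algebra_simps var_const_left_commute)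
    also have "\<dots> \<in> short_words (Suc (Suc (length w)))"
    proof (intro short_words_add short_words_scale)
      show "(var i * var j - const a * (var j * var i) - const b) * word w \<in> short_words (Suc (Suc (length w)))"
        using ab Cons.hyps by (intro short_words_ideal ideal_closed(4)) simp_all
      show "var j * (word (i # w) - const c * word (insort_key f i w)) \<in> short_words (Suc (Suc (length w)))"
        using c Cons.hyps by (intro short_words_var_mult)
      show "word w \<in> short_words (Suc (Suc (length w)))"
        using Cons.hyps by (intro short_words_word) simp_all
    qed
    finally show ?thesis
      using False by auto
  qed
qed

text \<open>This is insertion sort: the tail is sorted, then the head is inserted, and the two
  scalars multiply.\<close>

lemma word_sort:
  assumes "w \<in> lists V"
  shows "\<exists>a. word w - const a * word (sort_key f w) \<in> short_words (length w)"
  using assms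
proof (induction w)
  case Nil
  show ?case
    by (intro exI[of _ 1]) (simp add: short_words_ideal ideal_closed(1))
next
  case (Cons i w)
  obtain a where a: "word w - const a * word (sort_key f w) \<in> short_words (length w)"
    using Cons.IH by blast
  have "sort_key f w \<in> lists V"
    using Cons.hyps by (simp add: lists_eq_set)
  then obtain b where b: "word (i # sort_key f w) - const b * word (insort_key f i (sort_key f w))
      \<in> short_words (Suc (length w))"
    using word_Cons_insort[of i "sort_key f w"] Cons.hyps by auto
  have "word (i # w) - const (a * b) * word (sort_key f (i # w)) =
      var i * (word w - const a * word (sort_key f w))
      + const a * (word (i # sort_key f w) - const b * word (insort_key f i (sort_key f w)))"
    by (simp add: single_Cons algebra_simps var_const_left_commute)
  also have "\<dots> \<in> short_words (Suc (length w))"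
    using a b Cons.hyps by (intro short_words_add short_words_scale short_words_var_mult)
  finally show ?case
    by auto
qed

abbreviation sorted_words :: "'v list set" where
  "sorted_words \<equiv> {w \<in> lists V. sorted (map f w)}"

text \<open>Induction on the degree: a word of length \<open>m\<close> differs from a multiple of
  its sorted form by an element of \<open>short_words m\<close>, which the induction hypothesis
  covers.\<close>

lemma short_words_subset_span_sorted:
  "short_words m \<subseteq> free_algebra.span (I \<union> word ` sorted_words)"
proof (induction m)
  case 0
  show ?case
    unfolding short_words_def by (rule free_algebra.span_mono) auto
next
  case (Suc m)
  have "word w \<in> free_algebra.span (I \<union> word ` sorted_words)"
    if w: "w \<in> lists V" "length w < Suc m" for w
  proof (cases "length w < m")
    case True
    then show ?thesis
      using Suc short_words_word w(1) by blast
  next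
    case False
    obtain a where a: "word w - const a * word (sort_key f w) \<in> short_words (length w)"
      using word_sort[OF w(1)] by blast
    have "sort_key f w \<in> sorted_words"
      using w(1) by (simp add: lists_eq_set)
    then have "const a * word (sort_key f w) \<in> free_algebra.span (I \<union> word ` sorted_words)"
      by (intro free_algebra.span_scale free_algebra.span_base) blast
    moreover have "length w = m"
      using False w(2) by simp
    ultimately have "(word w - const a * word (sort_key f w)) + const a * word (sort_key f w)
        \<in> free_algebra.span (I \<union> word ` sorted_words)"
      using a Suc by (intro free_algebra.span_add) auto
    then show ?thesis
      by simp
  qed
  then show ?case
    unfolding short_words_def
    by (intro free_algebra.span_minimal) (auto intro: free_algebra.span_base)
qed

text \<open>In a linear combination of elements of \<open>I\<close> and sorted words,
  \<open>t\<close> collects the sorted words.\<close>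

lemma straighten:
  assumes "Poly_Mapping.keys p \<subseteq> lists V"
  shows "\<exists>t. Poly_Mapping.keys t \<subseteq> sorted_words \<and> p - t \<in> I"
proof -
  have "p \<in> free_algebra.span (I \<union> word ` sorted_words)"
    using assms
  proof (induction rule: poly_mapping_keys_induct)
    case (single w c)
    have "word w \<in> free_algebra.span (I \<union> word ` sorted_words)"
      using single short_words_subset_span_sorted[of "Suc (length w)"] by (auto intro: short_words_word)
    then show ?case
      using free_algebra.span_scale[of "word w" _ c] by (simp add: const_single)
  qed (simp_all add: free_algebra.span_zero free_algebra.span_add)
  then show ?thesis
  proof (induction rule: free_algebra.span_induct_alt)
    case base
    show ?case
      by (intro exI[of _ 0]) (simp add: ideal_closed(1))
  next
    case (step c p r)
    then obtain t where t: "Poly_Mapping.keys t \<subseteq> sorted_words" "r - t \<in> I"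
      by blast
    from step(1) show ?case
    proof
      assume "p \<in> I"
      then have "const c * p + (r - t) \<in> I"
        using t(2) by (intro ideal_closed)
      then show ?case
        using t(1) by (intro exI[of _ t]) (simp add: add_diff_eq)
    next
      assume "p \<in> word ` sorted_words"
      then obtain w where w: "w \<in> sorted_words" "p = word w"
        by blast
      have "Poly_Mapping.keys (const c * p + t) \<subseteq> sorted_words"
        using w t(1) keys_add[of "const c * p" t] by (auto simp: const_single split: if_splits)
      then show ?case
        using t(2) by (intro exI[of _ "const c * p + t"]) simp
    qed
  qed
qed

end

lemma quotient_algebra_simps [simp]:
  "carrier (quotient_algebra A I) = carrier (A Quot I)"
  "monoid.mult (quotient_algebra A I) = monoid.mult (A Quot I)"
  "monoid.one (quotient_algebra A I) = monoid.one (A Quot I)"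
  "ring.zero (quotient_algebra A I) = ring.zero (A Quot I)"
  "ring.add (quotient_algebra A I) = ring.add (A Quot I)"
  "module.smult (quotient_algebra A I) = (\<lambda>c C. \<Union>a\<in>C. I +>\<^bsub>A\<^esub> (c \<odot>\<^bsub>A\<^esub> a))"
  by (simp_all add: quotient_algebra_def ring.extend_def module.fields_def)

text \<open>Ring isomorphisms ignore scalar multiplication, so results on factor rings carry over;
  compatibility with scalars is a separate matter.\<close>

lemma ring_iso_quotient_algebra: "ring_iso R (quotient_algebra A I) = ring_iso R (A Quot I)"
  by (simp add: ring_iso_def ring_hom_def)

section \<open>Presentations and the kernel of evaluation\<close>

context unital_algebra
begin

text \<open>The first isomorphism theorem yields a ring isomorphism. What remains is the action of
  scalars, defined on cosets by a union over all representatives.\<close>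

lemma quotient_free_algebra_isomorphic:
  fixes y :: "'v \<Rightarrow> 'r" and V :: "'v set"
  assumes surj: "evaluate y ` carrier (free_algebra V) = UNIV"
    and I: "I = {p \<in> carrier (free_algebra V). evaluate y p = 0}"
  shows "algebra_of_type scale \<simeq>\<^sub>a\<^sub>l\<^sub>g quotient_algebra (free_algebra V) I"
proof -
  let ?A = "free_algebra V :: ('k, 'v list \<Rightarrow>\<^sub>0 'k) module"
  note hom = evaluate_ring_hom_ring[of V y]
  have kernel: "a_kernel ?A (algebra_of_type scale) (evaluate y) = I"
    by (simp add: a_kernel_def' I)
  have ideal: "ideal I ?A"
    using ring_hom_ring.kernel_is_ideal[OF hom] by (simp add: kernel)
  have subset: "I \<subseteq> carrier ?A"
    by (auto simp: I)
  \<comment> \<open>\<open>h\<close> inverts the isomorphism induced by evaluation, so it sends a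
    value to the coset of any of its preimages.\<close>
  obtain h where iso: "h \<in> ring_iso (algebra_of_type scale) (?A Quot I)"
    and coset: "\<And>p. p \<in> carrier ?A \<Longrightarrow> h (evaluate y p) = I +>\<^bsub>?A\<^esub> p"
  proof
    let ?k = "\<lambda>X. the_elem (evaluate y ` X)"
    have k: "?k \<in> ring_iso (?A Quot I) (algebra_of_type scale)"
      using ring_hom_ring.FactRing_iso_set[OF hom] surj by (simp add: kernel)
    then show "inv_into (carrier (?A Quot I)) ?k \<in> ring_iso (algebra_of_type scale) (?A Quot I)"
      by (rule ring_iso_set_sym[OF ideal.quotient_is_ring[OF ideal]])
    show "inv_into (carrier (?A Quot I)) ?k (evaluate y p) = I +>\<^bsub>?A\<^esub> p" if "p \<in> carrier ?A" for p
    proof (rule inv_into_f_eq)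
      show "inj_on ?k (carrier (?A Quot I))"
        using k by (simp add: ring_iso_def bij_betw_def)
      show "I +>\<^bsub>?A\<^esub> p \<in> carrier (?A Quot I)"
        using abelian_group.a_rcosetsI[OF ring.is_abelian_group[OF ring_free_algebra] subset that]
        by (simp add: FactRing_def)
      show "?k (I +>\<^bsub>?A\<^esub> p) = evaluate y p"
        using ring_hom_ring.the_elem_simp[OF hom that] by (simp add: kernel)
    qed
  qed
  have "h (scale c a) = (\<Union>p\<in>h a. I +>\<^bsub>?A\<^esub> (c \<odot>\<^bsub>?A\<^esub> p))" for c a
  proof -
    have smult: "h (scale c (evaluate y p)) = I +>\<^bsub>?A\<^esub> (c \<odot>\<^bsub>?A\<^esub> p)" if "p \<in> carrier ?A" for p
    proof -
      have "c \<odot>\<^bsub>?A\<^esub> p \<in> carrier ?A"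
        using that by (simp add: keys_mult_lists)
      from coset[OF this] show ?thesis
        by (simp add: evaluate_const_mult)
    qed
    obtain p where p: "p \<in> carrier ?A" "a = evaluate y p"
      using surj by (metis UNIV_I imageE)
    \<comment> \<open>Every representative of the coset \<open>h a\<close> evaluates to
      \<open>a\<close>, so all members of the union are the same coset.\<close>
    have "I +>\<^bsub>?A\<^esub> (c \<odot>\<^bsub>?A\<^esub> p') = h (scale c a)" if "p' \<in> h a" for p'
    proof -
      from that p obtain z where z: "z \<in> I" "p' = z + p"
        by (auto simp: coset a_r_coset_def')
      with p have "p' \<in> carrier ?A"
        using keys_add[of z p] by (auto simp: I)
      moreover have "evaluate y p' = a"
        using z p by (simp add: I evaluate_add)
      ultimately show ?thesis
        using smult[of p'] by simp
    qed
    \<comment> \<open>The union must range over a non-empty set in order to equal that common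
      coset.\<close>
    moreover have "p \<in> h a"
      using p additive_subgroup.zero_closed[OF ideal.axioms(1)[OF ideal]]
      by (auto simp: coset a_r_coset_def')
    ultimately show ?thesis
      by blast
  qed
  with iso show ?thesis
    unfolding algebra_isomorphic_def ring_iso_quotient_algebra by auto
qed

text \<open>The ideal of \<open>S\<close> lies in the kernel because the relators vanish.
  Conversely, an element of the kernel is congruent modulo the ideal to a combination of sorted
  words, which also evaluates to zero and so vanishes by independence.\<close>

lemma presented_algebra_isomorphic:
  fixes y :: "'v \<Rightarrow> 'r" and V :: "'v set" and f :: "'v \<Rightarrow> 'o::linorder"
  assumes S: "S \<subseteq> carrier (free_algebra V)"
    and vanish: "\<And>s. s \<in> S \<Longrightarrow> evaluate y s = 0"
    and generated: "generated_subalgebra scale (y ` V) = UNIV"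
    and exchange: "\<And>i j. \<lbrakk>i \<in> V; j \<in> V; f j < f i\<rbrakk>
      \<Longrightarrow> \<exists>a b. var i * var j - const a * (var j * var i) - const b \<in> Idl\<^bsub>free_algebra V\<^esub> S"
    and independent: "\<And>p. \<lbrakk>Poly_Mapping.keys p \<subseteq> {w \<in> lists V. sorted (map f w)}; evaluate y p = 0\<rbrakk>
      \<Longrightarrow> p = 0"
  shows "algebra_of_type scale \<simeq>\<^sub>a\<^sub>l\<^sub>g presented_algebra V S"
proof -
  let ?A = "free_algebra V :: ('k, 'v list \<Rightarrow>\<^sub>0 'k) module"
  let ?K = "{p \<in> carrier ?A. evaluate y p = 0}"
  have ideal: "ideal (Idl\<^bsub>?A\<^esub> S) ?A"
    by (rule ring.genideal_ideal[OF ring_free_algebra S])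
  have "a_kernel ?A (algebra_of_type scale) (evaluate y) = ?K"
    by (simp add: a_kernel_def')
  then have "Idl\<^bsub>?A\<^esub> S \<subseteq> ?K"
    using ring_hom_ring.kernel_is_ideal[OF evaluate_ring_hom_ring, of V y] S vanish
    by (intro ring.genideal_minimal[OF ring_free_algebra]) auto
  moreover have "p \<in> Idl\<^bsub>?A\<^esub> S" if "p \<in> ?K" for p
  proof -
    from that obtain t where t: "Poly_Mapping.keys t \<subseteq> {w \<in> lists V. sorted (map f w)}"
      "p - t \<in> Idl\<^bsub>?A\<^esub> S"
      using straighten[OF ideal exchange, where f = f and p = p] by auto
    with \<open>Idl\<^bsub>?A\<^esub> S \<subseteq> ?K\<close> have "evaluate y (p - t) = 0"
      by blast
    with that have "evaluate y t = 0"
      by (simp add: evaluate_diff)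
    with t independent show ?thesis
      by force
  qed
  ultimately have "Idl\<^bsub>?A\<^esub> S = ?K"
    by blast
  then show ?thesis
    using quotient_free_algebra_isomorphic[OF evaluate_image_free_algebra[OF generated]]
    by (simp add: presented_algebra_def)
qed

end

section \<open>Directed graphs with in- and out-degrees at most one\<close>

text \<open>A longest directed path absorbs all neighbours of its vertices, so connectedness makes
  it spanning. The extra pair \<open>(last p, hd p)\<close> allows for a directed cycle.\<close>

lemma spanning_path:
  fixes V :: "'v set"
  assumes fin: "finite V" and nonempty: "V \<noteq> {}" and sub: "D \<subseteq> V \<times> V"
    and out: "\<And>a b c. (a, b) \<in> D \<Longrightarrow> (a, c) \<in> D \<Longrightarrow> b = c"
    and into: "\<And>a b c. (a, c) \<in> D \<Longrightarrow> (b, c) \<in> D \<Longrightarrow> a = b"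
    and conn: "\<And>a b. a \<in> V \<Longrightarrow> b \<in> V \<Longrightarrow> (a, b) \<in> (D \<union> D\<inverse>)\<^sup>*"
  obtains p where "distinct p" "set p = V"
    "\<And>i. Suc i < length p \<Longrightarrow> (p ! i, p ! Suc i) \<in> D"
    "D \<subseteq> {(p ! i, p ! Suc i) | i. Suc i < length p} \<union> {(last p, hd p)}"
proof -
  let ?E = "\<lambda>a b. (a, b) \<in> D"
  let ?path = "\<lambda>p. p \<noteq> [] \<and> distinct p \<and> set p \<subseteq> V \<and> successively ?E p"
  obtain v where "v \<in> V" using nonempty by blast
  then have "?path [v]" by simp
  moreover have "length p < Suc (card V)" if "?path p" for p
    using that fin by (metis card_mono distinct_card less_Suc_eq_le)
  ultimately obtain p where p: "?path p" and max: "\<And>p'. ?path p' \<Longrightarrow> length p' \<le> length p"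
    using ex_has_greatest_nat[of ?path "[v]" length "Suc (card V)"] by blast
  have step: "(p ! i, p ! Suc i) \<in> D" if "Suc i < length p" for i
    using p that successively_conv_nth[of ?E p] by simp
  have forward: "(\<exists>i. Suc i < length p \<and> u = p ! i \<and> w = p ! Suc i) \<or> u = last p \<and> w = hd p"
    if "(u, w) \<in> D" "u \<in> set p" for u w
  proof -
    obtain i where i: "i < length p" "u = p ! i"
      using \<open>u \<in> set p\<close> by (metis in_set_conv_nth)
    show ?thesis
    proof (cases "Suc i < length p")
      case True
      then show ?thesis
        using step[OF True] out that(1) i by blast
    next
      case False
      then have u: "u = last p"
        using i p by (metis Suc_lessI diff_Suc_1 last_conv_nth)
      have "w \<in> set p"
      proof (rule ccontr)
        assume "w \<notin> set p"
        then have "?path (p @ [w])"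
          using p u that(1) sub by (auto simp: successively_append_iff)
        then show False
          using max[of "p @ [w]"] by simp
      qed
      then obtain j where j: "j < length p" "w = p ! j"
        by (metis in_set_conv_nth)
      \<comment> \<open>At a later position, \<open>w\<close> would have an arrow from its
        predecessor on the path as well as from \<open>u\<close>. These two would coincide, although
        \<open>u\<close> is the last vertex.\<close>
      have "j = 0"
      proof (rule ccontr)
        assume "j \<noteq> 0"
        then obtain l where l: "j = Suc l" by (cases j) auto
        then have "p ! l = p ! i"
          using step[of l] j that(1) i into by blast
        then have "l = i"
          using p i j l by (simp add: nth_eq_iff_index_eq)
        then show False
          using False j l by simp
      qed
      then show ?thesis
        using u j p by (simp add: hd_conv_nth)
    qed
  qed
  \<comment> \<open>A new vertex pointing at the head would lengthen the path; pointing at a later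
    vertex, it would be the predecessor already on the path.\<close>
  have backward: "u \<in> set p" if "(u, w) \<in> D" "w \<in> set p" for u w
  proof (rule ccontr)
    assume u: "u \<notin> set p"
    obtain j where j: "j < length p" "w = p ! j"
      using \<open>w \<in> set p\<close> by (metis in_set_conv_nth)
    show False
    proof (cases j)
      case 0
      then have "?path (u # p)"
        using p u j that(1) sub by (auto simp: successively_Cons hd_conv_nth)
      then show False
        using max[of "u # p"] by simp
    next
      case (Suc l)
      then have "u = p ! l"
        using step[of l] j that(1) into by blast
      then show False
        using u j Suc by simp
    qed
  qed
  have "b \<in> set p" if "(hd p, b) \<in> (D \<union> D\<inverse>)\<^sup>*" for b
    using that
  proof (induction rule: rtrancl_induct)
    case base
    then show ?case using p by simp
  next
    case (step a b)
    then show ?case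
      using forward[of a b] backward[of b a] p by auto
  qed
  moreover have "hd p \<in> V"
    using p by auto
  ultimately have "set p = V"
    using conn p by blast
  then show thesis
    using that[of p] p step forward sub by blast
qed

section \<open>Structure of connected quantized Weyl algebras\<close>

text \<open>Multiplication by \<open>- inverse a\<close> solves the relation for the opposite
  product, so one relator serves both orders of its two generators.\<close>

lemma exchange_swap:
  assumes ideal: "ideal I (free_algebra V)" and "a \<noteq> 0"
    and mem: "var j * var i - const a * (var i * var j) - const b \<in> I"
  shows "var i * var j - const (inverse a) * (var j * var i) - const (- inverse a * b) \<in> I"
proof -
  have "const (- inverse a) * (var j * var i - const a * (var i * var j) - const b)
      = const (- inverse a) * (var j * var i) - const (- inverse a * a) * (var i * var j)
        - const (- inverse a * b)"
    by (simp only: right_diff_distrib const_mult mult.assoc)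
  also have "const (- inverse a * a) = - (1 :: 'a list \<Rightarrow>\<^sub>0 'b)"
    using \<open>a \<noteq> 0\<close> by (simp add: const_uminus)
  finally have "var i * var j - const (inverse a) * (var j * var i) - const (- inverse a * b)
      = const (- inverse a) * (var j * var i - const a * (var i * var j) - const b)"
    by (simp add: const_uminus)
  also have "\<dots> \<in> I"
    using ideal.I_l_closed[OF ideal mem, of "const (- inverse a)"] by simp
  finally show ?thesis .
qed

context connected_quantized_weyl_algebra
begin

text \<open>Each generator is the standard monomial of a unit exponent vector, so both properties
  are inherited from the monomial basis.\<close>

lemma x_basis:
  shows "inj_on x {1..n}" and "independent (x ` {1..n})"
proof -
  \<comment> \<open>The restriction to \<open>{1..n}\<close> places the unit vectors in the
    extensional function space \<open>exponents n\<close>.\<close>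
  define e where "e i = (\<lambda>k\<in>{1..n}. if k = i then 1 else 0 :: nat)" for i
  have e_apply: "e i k = (if k = i then 1 else 0)" if "k \<in> {1..n}" for i k
    using that by (simp add: e_def)
  have monomial: "standard_monomial n x (e i) = x i" if i: "i \<in> {1..n}" for i
  proof -
    have "prod_list (map (\<lambda>k. x k ^ e i k) [1..<Suc m]) = (if i \<le> m then x i else 1)"
      if "m \<le> n" for m
      using that
    proof (induction m)
      case 0
      then show ?case using i by simp
    next
      case (Suc m)
      then have "e i (Suc m) = (if Suc m = i then 1 else 0)"
        by (intro e_apply) simp
      with Suc show ?case by (auto simp: le_Suc_eq)
    qed
    from this[of n] show ?thesis
      using i by (simp add: standard_monomial_def)
  qed
  have "inj_on e {1..n}"
  proof (rule inj_onI)
    fix i j assume "i \<in> {1..n}" "j \<in> {1..n}" "e i = e j"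
    moreover have "e i i = 1"
      using e_apply[of i i] \<open>i \<in> {1..n}\<close> by simp
    ultimately have "e j i = 1"
      by metis
    then show "i = j"
      using e_apply[OF \<open>i \<in> {1..n}\<close>, of j] by (metis zero_neq_one)
  qed
  moreover have "e ` {1..n} \<subseteq> exponents n"
    by (auto simp: exponents_def e_def)
  ultimately have "inj_on (standard_monomial n x \<circ> e) {1..n}"
    by (intro comp_inj_on inj_on_subset[OF monomials_inj])
  then show "inj_on x {1..n}"
    using inj_on_cong[of "{1..n}" "standard_monomial n x \<circ> e" x] monomial by simp
  have "x ` {1..n} = standard_monomial n x ` e ` {1..n}"
    unfolding image_image using monomial by (intro image_cong refl) simp
  then have "x ` {1..n} \<subseteq> standard_monomial n x ` exponents n"
    using \<open>e ` {1..n} \<subseteq> exponents n\<close> by blast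
  then show "independent (x ` {1..n})"
    by (rule independent_mono[OF monomials_independent])
qed

text \<open>Reordering \<open>x\<^sub>i x\<^sub>j x\<^sub>k\<close> in two ways leaves a linear relation between \<open>x\<^sub>i\<close>, \<open>x\<^sub>j\<close> and \<open>x\<^sub>k\<close>
  in which \<open>x\<^sub>i\<close> has coefficient \<open>r j k * (q i j * q i k - 1)\<close>.\<close>

lemma q_mult_edge:
  assumes ijk: "i \<in> {1..n}" "j \<in> {1..n}" "k \<in> {1..n}" "i \<noteq> j" "i \<noteq> k" "j \<noteq> k"
    and edge: "r j k \<noteq> 0"
  shows "q i j * q i k = 1"
proof (rule ccontr)
  assume ne: "q i j * q i k \<noteq> 1"
  note rel = relations[OF ijk(1,2,4)] relations[OF ijk(1,3,5)] relations[OF ijk(2,3,6)]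
  note simps = scale_mult_left scale_mult_right scale_right_distrib distrib_left distrib_right
  \<comment> \<open>The first reordering moves \<open>x i\<close> past \<open>x j\<close> and
    \<open>x k\<close>, then exchanges these two; the target is
    \<open>x k * x j * x i\<close>.\<close>
  have "x i * x j * x k = scale (q i j) (x j * (x i * x k)) + scale (r i j) (x k)"
    by (simp add: rel(1) simps mult.assoc)
  also have "\<dots> = scale (q i j * q i k) (x j * x k * x i) + scale (q i j * r i k) (x j) + scale (r i j) (x k)"
    by (simp add: rel(2) simps mult.assoc)
  also have "\<dots> = scale (q i j * q i k * q j k) (x k * x j * x i) + scale (q i j * q i k * r j k) (x i)
      + scale (q i j * r i k) (x j) + scale (r i j) (x k)"
    by (simp add: rel(3) simps mult.assoc)
  finally have 1: "x i * x j * x k = \<dots>" .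
  \<comment> \<open>The second reordering starts by exchanging \<open>x j\<close> and
    \<open>x k\<close>. Its leading term has the same coefficient and will cancel.\<close>
  have "x i * (x j * x k) = scale (q j k) (x i * x k * x j) + scale (r j k) (x i)"
    by (simp add: rel(3) simps mult.assoc)
  also have "\<dots> = scale (q j k * q i k) (x k * (x i * x j)) + scale (q j k * r i k) (x j) + scale (r j k) (x i)"
    by (simp add: rel(2) simps mult.assoc)
  also have "\<dots> = scale (q i j * q i k * q j k) (x k * x j * x i) + scale (q j k * q i k * r i j) (x k)
      + scale (q j k * r i k) (x j) + scale (r j k) (x i)"
    by (simp add: rel(1) simps mult.assoc mult.commute mult.left_commute)
  finally have 2: "x i * (x j * x k) = \<dots>" .
  define \<alpha> where "\<alpha> = r j k * (q i j * q i k - 1)"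
  define w where "w = scale (q j k * r i k - q i j * r i k) (x j) + scale (q j k * q i k * r i j - r i j) (x k)"
  have "scale (q i j * q i k * r j k) (x i) + scale (q i j * r i k) (x j) + scale (r i j) (x k) =
      scale (q j k * q i k * r i j) (x k) + scale (q j k * r i k) (x j) + scale (r j k) (x i)"
    using 1 2 by (simp only: mult.assoc add.assoc add_left_cancel)
  then have "scale \<alpha> (x i) = w"
    by (simp add: \<alpha>_def w_def algebra_simps)
  moreover have "\<alpha> \<noteq> 0"
    using ne edge by (simp add: \<alpha>_def)
  \<comment> \<open>A non-zero \<open>\<alpha>\<close> would express \<open>x i\<close> through the
    other generators, against their independence.\<close>
  ultimately have "x i = scale (inverse \<alpha>) w"
    by (metis left_inverse scale_one scale_scale)
  moreover have "w \<in> span (x ` {1..n} - {x i})"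
    unfolding w_def using ijk x_basis(1)
    by (intro span_add span_scale span_base) (auto dest: inj_onD)
  ultimately have "x i \<in> span (x ` {1..n} - {x i})"
    by (metis span_scale)
  then show False
    using x_basis(2) ijk(1) by (auto simp: dependent_def)
qed

text \<open>A sorted word is a concatenation of constant blocks, one for each index, whose lengths
  are the multiplicities; each block evaluates to a power.\<close>

lemma prod_list_sorted:
  assumes "sorted u" "set u \<subseteq> {1..n}"
  shows "prod_list (map x u) = standard_monomial n x (\<lambda>i\<in>{1..n}. count_list u i)"
proof -
  let ?s = "\<lambda>m. concat (map (\<lambda>i. replicate (count_list u i) i) [1..<Suc m])"
  have set_s: "set (?s m) \<subseteq> {1..m}" for m
    by auto
  have "sorted (?s m)" for m
  proof (induction m)
    case (Suc m)
    then show ?case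
      using set_s[of m] by (force simp: sorted_append)
  qed simp
  moreover have "mset (?s n) = mset u"
  proof (rule multiset_eqI)
    fix i
    have "count (mset (?s m)) i = (if i \<in> {1..m} then count_list u i else 0)" for m
      by (induction m) (auto simp: le_Suc_eq simp flip: count_mset)
    then show "count (mset (?s n)) i = count (mset u) i"
      using assms(2) by (auto simp: count_mset count_list_0_iff)
  qed
  ultimately have "u = ?s n"
    using assms(1) by (metis properties_for_sort)
  then have "prod_list (map x u) = prod_list (map x (?s n))"
    by simp
  also have "\<dots> = prod_list (map (\<lambda>i. x i ^ count_list u i) [1..<Suc n])"
  proof -
    have "prod_list (map x (?s m)) = prod_list (map (\<lambda>i. x i ^ count_list u i) [1..<Suc m])" for m
      by (induction m) simp_all
    then show ?thesis .
  qed
  also have "\<dots> = standard_monomial n x (\<lambda>i\<in>{1..n}. count_list u i)"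
    unfolding standard_monomial_def by (intro arg_cong[of _ _ prod_list] map_cong) auto
  finally show ?thesis .
qed

end

lemma (in unital_algebra) prod_list_scale:
  "prod_list (map (\<lambda>i. scale (c i) (z i)) w) = scale (prod_list (map c w)) (prod_list (map z w))"
  by (induction w) (simp_all add: scale_mult_left scale_mult_right mult.commute)

lemma (in unital_algebra) generated_subalgebra_least:
  assumes "a \<in> generated_subalgebra scale X" "X \<subseteq> generated_subalgebra scale Y"
  shows "a \<in> generated_subalgebra scale Y"
  using assms(1)
proof (induction rule: generated_subalgebra.induct)
  case (gen x)
  then show ?case using assms(2) by blast
qed (blast intro: generated_subalgebra.intros)+

section \<open>Sorted words as a basis up to non-zero scalars\<close>

context connected_quantized_weyl_algebra
begin

text \<open>A word sorted by \<open>v\<close> evaluates to a non-zero multiple of a standard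
  monomial. The monomial determines the multiset of letters, hence the sorted word, so distinct
  words give distinct basis elements.\<close>

lemma sorted_words_independent:
  assumes v: "inj_on v V" "v ` V \<subseteq> {1..n}"
    and c: "\<And>i. i \<in> V \<Longrightarrow> c i \<noteq> 0"
    and keys: "Poly_Mapping.keys p \<subseteq> {w \<in> lists V. sorted (map v w)}" (is "_ \<subseteq> ?W")
    and zero: "evaluate (\<lambda>i. scale (c i) (x (v i))) p = 0"
  shows "p = 0"
proof -
  define monomial where "monomial w = prod_list (map x (map v w))" for w
  define e where "e w = (\<lambda>i\<in>{1..n}. count_list (map v w) i)" for w
  \<comment> \<open>\<open>u w\<close> is the coefficient of \<open>monomial w\<close> after
    evaluation: the rescaling factors of all letters are gathered in front.\<close>
  define u where "u w = Poly_Mapping.lookup p w * prod_list (map c w)" for w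
  have set_map: "set (map v w) \<subseteq> {1..n}" if "w \<in> ?W" for w
    using that v(2) by auto
  have monomial: "monomial w = standard_monomial n x (e w)" if "w \<in> ?W" for w
    unfolding monomial_def e_def using that by (intro prod_list_sorted set_map) simp_all
  have e: "e w \<in> exponents n" for w
    by (simp add: e_def exponents_def)
  have inj: "inj_on monomial ?W"
  proof (rule inj_onI)
    fix w w' assume w: "w \<in> ?W" and w': "w' \<in> ?W" and eq: "monomial w = monomial w'"
    have "e w = e w'"
      using inj_onD[OF monomials_inj _ e e] eq monomial[OF w] monomial[OF w'] by simp
    have "count_list (map v w) i = count_list (map v w') i" for i
    proof (cases "i \<in> {1..n}")
      case True
      then show ?thesis
        using fun_cong[OF \<open>e w = e w'\<close>, of i] by (simp only: e_def restrict_apply if_True)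
    next
      case False
      then have "i \<notin> set (map v w)" "i \<notin> set (map v w')"
        using set_map[OF w] set_map[OF w'] by blast+
      then show ?thesis
        by (simp only: count_notin not_False_eq_True)
    qed
    then have "mset (map v w) = mset (map v w')"
      by (intro multiset_eqI) (simp only: count_mset)
    then have "map v w = map v w'"
      using w w' by (metis (mono_tags, lifting) mem_Collect_eq properties_for_sort)
    moreover have "inj_on v (set w \<union> set w')"
      using w w' by (intro inj_on_subset[OF v(1)]) auto
    ultimately show "w = w'"
      using inj_on_map_eq_map by blast
  qed
  have "0 = (\<Sum>w\<in>Poly_Mapping.keys p. scale (u w) (monomial w))"
    using zero by (simp add: evaluate_def prod_list_scale u_def monomial_def comp_def)
  \<comment> \<open>Since \<open>monomial\<close> is injective on the support, the sum becomes one
    over a set of basis vectors without merging any coefficients.\<close>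
  also have "\<dots> = (\<Sum>b\<in>monomial ` Poly_Mapping.keys p.
      scale (u (inv_into (Poly_Mapping.keys p) monomial b)) b)"
    using inj_on_subset[OF inj keys] by (simp add: sum.reindex)
  finally have sum: "(\<Sum>b\<in>monomial ` Poly_Mapping.keys p.
      scale (u (inv_into (Poly_Mapping.keys p) monomial b)) b) = 0"
    by simp
  have sub: "monomial ` Poly_Mapping.keys p \<subseteq> standard_monomial n x ` exponents n"
    using keys monomial e by blast
  have "w \<notin> Poly_Mapping.keys p" for w
  proof
    assume w: "w \<in> Poly_Mapping.keys p"
    have "u (inv_into (Poly_Mapping.keys p) monomial (monomial w)) = 0"
      using independentD[OF monomials_independent _ sub sum] w by simp
    then have "u w = 0"
      using w inj_on_subset[OF inj keys] by simp
    moreover have "\<forall>i\<in>set w. c i \<noteq> 0"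
      using w keys c by auto
    ultimately show False
      using w by (auto simp: u_def prod_list_zero_iff in_keys_iff)
  qed
  then show ?thesis
    by (metis equals0I keys_eq_empty)
qed

text \<open>The criterion is applied to the generators \<open>scale (c i) (x (v i))\<close> with
  words ordered by \<open>v\<close>, that is, in the original order of the \<open>x i\<close>. Where
  this order disagrees with the orientation of a relator, \<open>a \<noteq> 0\<close> allows it to
  be reversed.\<close>

lemma isomorphic_presented_algebra:
  assumes v: "bij_betw v {1..n} {1..n}"
    and c: "\<And>i. i \<in> {1..n} \<Longrightarrow> c i \<noteq> 0"
    and S: "S \<subseteq> carrier (free_algebra {1..n})"
    and vanish: "\<And>s. s \<in> S \<Longrightarrow> evaluate (\<lambda>i. scale (c i) (x (v i))) s = 0"
    and exchange: "\<And>i j. \<lbrakk>1 \<le> i; i < j; j \<le> n\<rbrakk> \<Longrightarrow> \<exists>a b. a \<noteq> 0 \<and>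
      (var i * var j - const a * (var j * var i) - const b \<in> S \<or>
       var j * var i - const a * (var i * var j) - const b \<in> S)"
  shows "algebra_of_type scale \<simeq>\<^sub>a\<^sub>l\<^sub>g presented_algebra {1..n} S"
proof (rule presented_algebra_isomorphic[OF S vanish])
  let ?y = "\<lambda>i. scale (c i) (x (v i))"
  let ?A = "free_algebra {1..n} :: ('k, nat list \<Rightarrow>\<^sub>0 'k) module"
  have "x ` {1..n} \<subseteq> generated_subalgebra scale (?y ` {1..n})"
  proof
    fix a assume "a \<in> x ` {1..n}"
    then have "a \<in> x ` v ` {1..n}"
      using bij_betw_imp_surj_on[OF v] by (simp only:)
    then obtain i where i: "i \<in> {1..n}" "a = x (v i)"
      by blast
    have "scale (inverse (c i)) (?y i) \<in> generated_subalgebra scale (?y ` {1..n})"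
      by (intro generated_subalgebra.scale generated_subalgebra.gen imageI i(1))
    moreover have "scale (inverse (c i)) (?y i) = a"
      using i c[OF i(1)] by simp
    ultimately show "a \<in> generated_subalgebra scale (?y ` {1..n})"
      by (simp only:)
  qed
  then show "generated_subalgebra scale (?y ` {1..n}) = UNIV"
    using generators generated_subalgebra_least by blast
  have ideal: "ideal (Idl\<^bsub>?A\<^esub> S) ?A" and self: "S \<subseteq> Idl\<^bsub>?A\<^esub> S"
    using ring.genideal_ideal[OF ring_free_algebra S] ring.genideal_self[OF ring_free_algebra S]
    by simp_all
  have *: "\<exists>a b. var i * var j - const a * (var j * var i) - const b \<in> Idl\<^bsub>?A\<^esub> S"
    if "a \<noteq> 0" "var i * var j - const a * (var j * var i) - const b \<in> S \<or>
       var j * var i - const a * (var i * var j) - const b \<in> S" for i j a b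
    using that self exchange_swap[OF ideal] by blast
  show "\<exists>a b. var i * var j - const a * (var j * var i) - const b \<in> Idl\<^bsub>?A\<^esub> S"
    if ij: "i \<in> {1..n}" "j \<in> {1..n}" "v j < v i" for i j
  proof (cases i j rule: linorder_cases)
    case less
    then obtain a b where "a \<noteq> 0" "var i * var j - const a * (var j * var i) - const b \<in> S \<or>
        var j * var i - const a * (var i * var j) - const b \<in> S"
      using exchange[of i j] ij by auto
    then show ?thesis
      by (rule *)
  next
    case greater
    then obtain a b where "a \<noteq> 0" "var j * var i - const a * (var i * var j) - const b \<in> S \<or>
        var i * var j - const a * (var j * var i) - const b \<in> S"
      using exchange[of j i] ij by auto
    then show ?thesis
      using *[of a i j b] by blast
  qed (use ij in simp)
  show "p = 0" if "Poly_Mapping.keys p \<subseteq> {w \<in> lists {1..n}. sorted (map v w)}"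
    "evaluate ?y p = 0" for p
    using sorted_words_independent[of v "{1..n}" c p] v c that by (simp add: bij_betw_def)
qed

text \<open>\<open>v\<close> follows the spanning path of arrows with \<open>q i j = t\<close>. Any
  further edge is the closing arrow from \<open>v n\<close> to \<open>v 1\<close>; its value of
  \<open>q\<close> is recorded because it decides the parity of \<open>n\<close>.\<close>

lemma enumeration:
  assumes t: "t \<noteq> 0" "t \<noteq> inverse t"
    and q: "\<And>i j. \<lbrakk>i \<in> {1..n}; j \<in> {1..n}; i \<noteq> j\<rbrakk> \<Longrightarrow> q i j = t \<or> q i j = inverse t"
  obtains v where "bij_betw v {1..n} {1..n}"
    "\<And>i. \<lbrakk>1 \<le> i; i < n\<rbrakk> \<Longrightarrow> r (v i) (v (Suc i)) \<noteq> 0"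
    "\<And>i j. \<lbrakk>1 \<le> i; i < j; j \<le> n; r (v i) (v j) \<noteq> 0\<rbrakk>
      \<Longrightarrow> j = Suc i \<or> i = 1 \<and> j = n \<and> q (v n) (v 1) = t"
    "\<And>i j. \<lbrakk>1 \<le> i; i < j; j \<le> n\<rbrakk> \<Longrightarrow> q (v i) (v j) = (if odd (j - i) then t else inverse t)"
proof -
  define D where "D = {(i, j). i \<in> {1..n} \<and> j \<in> {1..n} \<and> i \<noteq> j \<and> r i j \<noteq> 0 \<and> q i j = t}"
  have q_flip: "q j i = t" if "i \<in> {1..n}" "j \<in> {1..n}" "i \<noteq> j" "q i j = inverse t" for i j
    using that q_swap[of i j] by simp
  have r_flip: "r j i \<noteq> 0" if "i \<in> {1..n}" "j \<in> {1..n}" "i \<noteq> j" "r i j \<noteq> 0" for i j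
    using that r_swap[of i j] q_nonzero[of i j] by simp
  have edges: "(i, j) \<in> D \<union> D\<inverse>" if "(i, j) \<in> edges n r" for i j
    using that q[of i j] q_flip[of i j] r_flip[of i j] by (auto simp: D_def edges_def)
  have out: "b = c" if "(a, b) \<in> D" "(a, c) \<in> D" for a b c
  proof (rule ccontr)
    \<comment> \<open>The two edges at \<open>a\<close> force \<open>q c b = t\<close> and
      \<open>q b c = t\<close>. These are inverse to each other, so \<open>t = inverse t\<close>.
      Two arrows into one vertex are excluded likewise.\<close>
    assume "b \<noteq> c"
    with that have "q c a * q c b = 1" "q b a * q b c = 1"
      using q_mult_edge[of c a b] q_mult_edge[of b a c] by (auto simp: D_def)
    moreover have "q c a = inverse t" "q b a = inverse t" "q b c = inverse (q c b)"
      using that q_swap[of a b] q_swap[of a c] q_swap[of c b] \<open>b \<noteq> c\<close> by (auto simp: D_def)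
    ultimately show False
      using t by (metis inverse_inverse_eq inverse_unique)
  qed
  have into: "a = b" if "(a, c) \<in> D" "(b, c) \<in> D" for a b c
  proof (rule ccontr)
    assume "a \<noteq> b"
    with that have "q b a * q b c = 1" "q a b * q a c = 1"
      using q_mult_edge[of b a c] q_mult_edge[of a b c] by (auto simp: D_def)
    moreover have "q a c = t" "q b c = t" "q b a = inverse (q a b)"
      using that q_swap[of a b] \<open>a \<noteq> b\<close> by (auto simp: D_def)
    ultimately show False
      using t by (metis inverse_inverse_eq inverse_unique)
  qed
  have conn: "(a, b) \<in> (D \<union> D\<inverse>)\<^sup>*" if "a \<in> {1..n}" "b \<in> {1..n}" for a b
    using connected_graph[OF that] rtrancl_mono[OF subrelI[OF edges]] by blast
  obtain p where p: "distinct p" "set p = {1..n}"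
    and path: "\<And>i. Suc i < length p \<Longrightarrow> (p ! i, p ! Suc i) \<in> D"
    and D_sub: "D \<subseteq> {(p ! i, p ! Suc i) | i. Suc i < length p} \<union> {(last p, hd p)}"
  proof (rule spanning_path[of "{1..n}" D])
    show "{1..n} \<noteq> {}" using n_ge_2 by simp
    show "D \<subseteq> {1..n} \<times> {1..n}" by (auto simp: D_def)
  qed (use out into conn in \<open>blast | simp\<close>)+
  have len: "length p = n"
    using p by (metis card_atLeastAtMost diff_Suc_1 distinct_card)
  \<comment> \<open>List positions start at 0, indices of generators at 1.\<close>
  define v where "v i = p ! (i - 1)" for i
  have p_v: "p ! i = v (Suc i)" for i
    by (simp add: v_def)
  have bij: "bij_betw v {1..n} {1..n}"
  proof -
    have "bij_betw (\<lambda>i. i - 1) {1..n} {..<n}"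
      by (rule bij_betw_byWitness[where f' = Suc]) auto
    moreover have "bij_betw ((!) p) {..<n} {1..n}"
      using p len by (intro bij_betw_nth) auto
    ultimately have "bij_betw ((!) p \<circ> (\<lambda>i. i - 1)) {1..n} {1..n}"
      by (rule bij_betw_trans)
    then show ?thesis
      by (simp add: v_def[abs_def] comp_def)
  qed
  then have v_in: "v i \<in> {1..n}" if "i \<in> {1..n}" for i
    using that by (auto simp: bij_betw_def)
  have v_eq: "v i = v j \<longleftrightarrow> i = j" if "i \<in> {1..n}" "j \<in> {1..n}" for i j
    using bij that by (auto simp: bij_betw_def dest: inj_onD)
  have step: "(v i, v (Suc i)) \<in> D" if "1 \<le> i" "i < n" for i
    using path[of "i - 1"] that len by (simp add: v_def)
  have "p \<noteq> []"
    using len n_ge_2 by auto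
  then have ends: "hd p = v 1" "last p = v n"
    using len by (simp_all add: v_def hd_conv_nth last_conv_nth)
  have D_cases: "j = Suc i \<or> i = n \<and> j = 1" if "i \<in> {1..n}" "j \<in> {1..n}" "(v i, v j) \<in> D" for i j
  proof -
    have "(\<exists>k. Suc k < n \<and> v i = v (Suc k) \<and> v j = v (Suc (Suc k))) \<or> v i = v n \<and> v j = v 1"
      using that(3) D_sub by (auto simp: len ends p_v)
    then show ?thesis
      using that v_eq n_ge_2 by auto
  qed
  show thesis
  proof (rule that[OF bij])
    show edge: "r (v i) (v (Suc i)) \<noteq> 0" if "1 \<le> i" "i < n" for i
      using step[OF that] by (simp add: D_def)
    show "j = Suc i \<or> i = 1 \<and> j = n \<and> q (v n) (v 1) = t"
      if "1 \<le> i" "i < j" "j \<le> n" "r (v i) (v j) \<noteq> 0" for i j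
    proof -
      \<comment> \<open>The edge is an arrow in one direction. For \<open>i < j\<close> a backward
        arrow can only be the closing one.\<close>
      have "(v i, v j) \<in> D \<or> (v j, v i) \<in> D"
        using edges[of "v i" "v j"] that v_in[of i] v_in[of j] v_eq[of i j] by (auto simp: edges_def)
      then show ?thesis
        using D_cases[of i j] D_cases[of j i] that by (auto simp: D_def)
    qed
    show "q (v i) (v j) = (if odd (j - i) then t else inverse t)" if "1 \<le> i" "i < j" "j \<le> n" for i j
    proof -
      have "Suc i \<le> j"
        using that(2) by simp
      then show ?thesis
      proof (induction j rule: dec_induct)
        case base
        then show ?case
          using step[of i] that by (simp add: D_def)
      next
        case (step m)
        have "r (v m) (v (Suc m)) \<noteq> 0"
          using edge[of m] step.hyps that by simp
        \<comment> \<open>The path edge between \<open>v m\<close> and \<open>v (Suc m)\<close>,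
          seen from \<open>v i\<close>, makes these two values inverse; starting from
          \<open>t\<close> at \<open>Suc i\<close>, they alternate.\<close>
        then have "q (v i) (v m) * q (v i) (v (Suc m)) = 1"
          using step.hyps that v_eq[of i m] v_eq[of i "Suc m"] v_eq[of m "Suc m"]
          by (intro q_mult_edge v_in) auto
        then have "q (v i) (v (Suc m)) = inverse (q (v i) (v m))"
          by (metis inverse_unique)
        then show ?case
          using step.IH step.hyps by (simp add: Suc_diff_le)
      qed
    qed
  qed
qed

end

section \<open>Rescaling the generators and the final isomorphisms\<close>

text \<open>Starting from 1, each equation is solved for the next scalar. Where
  \<open>\<rho> i = 0\<close> there is no equation, and the chain restarts at 1.\<close>

lemma path_scalars:
  fixes \<rho> :: "nat \<Rightarrow> 'a::field"
  assumes "a \<noteq> 0"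
  obtains d where "\<And>i. d i \<noteq> 0" "\<And>i. \<rho> i \<noteq> 0 \<Longrightarrow> d i * d (Suc i) * \<rho> i = a"
proof
  define d where "d = rec_nat 1 (\<lambda>i z. if \<rho> i = 0 then 1 else a / (z * \<rho> i))"
  show nonzero: "d i \<noteq> 0" for i
    using assms by (induction i) (auto simp: d_def)
  show "d i * d (Suc i) * \<rho> i = a" if "\<rho> i \<noteq> 0" for i
    using that nonzero[of i] by (simp add: d_def)
qed

text \<open>Around a cycle of odd length, rescaling alternately by \<open>s\<close> and \<open>inverse s\<close> preserves the products
  along the path and multiplies the closing one by \<open>s\<^sup>2\<close>.\<close>

lemma cycle_scalars:
  fixes \<rho> :: "nat \<Rightarrow> 'a::alg_closed_field"
  assumes "a \<noteq> 0" "odd n" "\<rho>' \<noteq> 0"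
  obtains c where "\<And>i. c i \<noteq> 0" "\<And>i. \<rho> i \<noteq> 0 \<Longrightarrow> c i * c (Suc i) * \<rho> i = a"
    "c n * c 1 * \<rho>' = a"
proof -
  obtain d where d: "\<And>i. d i \<noteq> 0" "\<And>i. \<rho> i \<noteq> 0 \<Longrightarrow> d i * d (Suc i) * \<rho> i = a"
    using path_scalars[OF assms(1)] by blast
  \<comment> \<open>\<open>s ^ 2\<close> is the factor by which the closing product of the
    \<open>d i\<close> must be corrected.\<close>
  obtain s where s: "s ^ 2 = a / (d n * d 1 * \<rho>')"
    using nth_root_exists[of 2] by auto
  then have "s \<noteq> 0"
    using assms d by auto
  define c where "c i = (if odd i then s * d i else d i / s)" for i
  show thesis
  proof
    show "c i \<noteq> 0" for i
      using d(1) \<open>s \<noteq> 0\<close> by (simp add: c_def)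
    show "c i * c (Suc i) * \<rho> i = a" if "\<rho> i \<noteq> 0" for i
      using d(2)[OF that] \<open>s \<noteq> 0\<close> by (simp add: c_def)
    \<comment> \<open>Both 1 and \<open>n\<close> are odd, so both end scalars carry the factor
      \<open>s\<close>.\<close>
    have "c n * c 1 * \<rho>' = s ^ 2 * (d n * d 1 * \<rho>')"
      using \<open>odd n\<close> by (simp add: c_def power2_eq_square)
    also have "\<dots> = a"
      using s d(1) assms by simp
    finally show "c n * c 1 * \<rho>' = a" .
  qed
qed

section \<open>Shape of the relators of the two families\<close>

lemma keys_exchange_lists:
  fixes a :: "'k::field"
  assumes "i \<in> V" "j \<in> V"
  shows "Poly_Mapping.keys (var i * var j - const a * (var j * var i)) \<subseteq> lists V"
    and "Poly_Mapping.keys (var i * var j - const a * (var j * var i) - const b) \<subseteq> lists V"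
proof -
  have diff: "Poly_Mapping.keys (p - s) \<subseteq> lists V"
    if "Poly_Mapping.keys p \<subseteq> lists V" "Poly_Mapping.keys s \<subseteq> lists V" for p s :: "'a list \<Rightarrow>\<^sub>0 'k"
    using that keys_diff[of p s] by blast
  show "Poly_Mapping.keys (var i * var j - const a * (var j * var i)) \<subseteq> lists V"
    and "Poly_Mapping.keys (var i * var j - const a * (var j * var i) - const b) \<subseteq> lists V"
    using assms by (intro diff keys_mult_lists; simp)+
qed

lemma L_relators_carrier: "L_relators n q \<subseteq> carrier (free_algebra {1..n})"
proof
  fix s assume "s \<in> L_relators n q"
  then show "s \<in> carrier (free_algebra {1..n})"
    unfolding L_relators_def
    by (elim UnE CollectE exE conjE; simp add: keys_exchange_lists)
qed

lemma C_relators_carrier: "n \<ge> 1 \<Longrightarrow> C_relators n q \<subseteq> carrier (free_algebra {1..n})"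
proof
  fix s assume "n \<ge> 1" "s \<in> C_relators n q"
  then show "s \<in> carrier (free_algebra {1..n})"
    unfolding C_relators_def
    by (elim UnE CollectE exE conjE singletonE; simp add: keys_exchange_lists)
qed

lemma L_relators_exchange:
  assumes "q \<noteq> 0" "1 \<le> i" "i < j" "j \<le> n"
  shows "\<exists>a b. a \<noteq> 0 \<and> var i * var j - const a * (var j * var i) - const b \<in> L_relators n q"
proof -
  consider "j = i + 1" | "i + 1 < j" "odd (j - i)" | "i + 1 < j" "even (j - i)"
    using assms(3) by linarith
  then show ?thesis
  proof cases
    case 1
    then have "var i * var j - const q * (var j * var i) - const (1 - q) \<in> L_relators n q"
      using assms unfolding L_relators_def by blast
    with assms(1) show ?thesis
      by blast
  next
    case 2
    then have "var i * var j - const q * (var j * var i) \<in> L_relators n q"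
      using assms unfolding L_relators_def by blast
    then have "var i * var j - const q * (var j * var i) - const 0 \<in> L_relators n q"
      by simp
    with assms(1) show ?thesis
      by blast
  next
    case 3
    then have "var i * var j - const (inverse q) * (var j * var i) \<in> L_relators n q"
      using assms unfolding L_relators_def by blast
    then have "var i * var j - const (inverse q) * (var j * var i) - const 0 \<in> L_relators n q"
      by simp
    moreover have "inverse q \<noteq> 0"
      using assms(1) by simp
    ultimately show ?thesis
      by blast
  qed
qed

text \<open>The closing relator puts \<open>var n\<close> before \<open>var 1\<close>, hence the
  alternative; the other pairs use a relator with the smaller index first.\<close>

lemma C_relators_exchange:
  assumes "q \<noteq> 0" "1 \<le> i" "i < j" "j \<le> n"
  shows "\<exists>a b. a \<noteq> 0 \<and>
    (var i * var j - const a * (var j * var i) - const b \<in> C_relators n q \<or>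
     var j * var i - const a * (var i * var j) - const b \<in> C_relators n q)"
proof (cases "(i, j) = (1, n)")
  case True
  then have "var j * var i - const q * (var i * var j) - const (1 - q) \<in> C_relators n q"
    unfolding C_relators_def by blast
  with assms(1) show ?thesis
    by blast
next
  case False
  consider "j = i + 1" | "i + 1 < j" "odd (j - i)" | "i + 1 < j" "even (j - i)"
    using assms(3) by linarith
  then show ?thesis
  proof cases
    case 1
    then have "var i * var j - const q * (var j * var i) - const (1 - q) \<in> C_relators n q"
      using assms False unfolding C_relators_def by blast
    with assms(1) show ?thesis
      by blast
  next
    case 2
    then have "var i * var j - const q * (var j * var i) \<in> C_relators n q"
      using assms False unfolding C_relators_def by blast
    then have "var i * var j - const q * (var j * var i) - const 0 \<in> C_relators n q"
      by simp
    with assms(1) show ?thesis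
      by blast
  next
    case 3
    then have "var i * var j - const (inverse q) * (var j * var i) \<in> C_relators n q"
      using assms False unfolding C_relators_def by blast
    then have "var i * var j - const (inverse q) * (var j * var i) - const 0 \<in> C_relators n q"
      by simp
    moreover have "inverse q \<noteq> 0"
      using assms(1) by simp
    ultimately show ?thesis
      by blast
  qed
qed

section \<open>Classification: paths give \<open>L_algebra\<close>, cycles give
  \<open>C_algebra\<close>\<close>

lemma (in unital_algebra) evaluate_exchange:
  "evaluate y (var i * var j - const a * (var j * var i)) = y i * y j - scale a (y j * y i)"
  by (simp only: evaluate_diff evaluate_const_mult) (simp add: evaluate_mult)

theorem proposition2p16:
  fixes scale :: "'k::alg_closed_field \<Rightarrow> 'r::ring_1 \<Rightarrow> 'r"
    and n :: nat and x :: "nat \<Rightarrow> 'r"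
    and qs rs :: "nat \<Rightarrow> nat \<Rightarrow> 'k" and q :: 'k
  assumes "connected_quantized_weyl_algebra scale n x qs rs"
    and "q \<noteq> 0"
    and "{qs i j | i j. i \<in> {1..n} \<and> j \<in> {1..n} \<and> i \<noteq> j} = {q, inverse q}"
    and "q \<noteq> 1" and "q \<noteq> -1"
  shows "algebra_of_type scale \<simeq>\<^sub>a\<^sub>l\<^sub>g L_algebra n q
    \<or> odd n \<and> algebra_of_type scale \<simeq>\<^sub>a\<^sub>l\<^sub>g C_algebra n q"
proof -
  interpret connected_quantized_weyl_algebra scale n x qs rs
    by (rule assms(1))
  \<comment> \<open>Equality would mean that \<open>q\<close> squares to 1, which only 1 and -1
    do.\<close>
  have "q \<noteq> inverse q"
    using assms(2,4,5) square_eq_1_iff[of q] right_inverse[of q] by metis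
  moreover have "qs i j = q \<or> qs i j = inverse q" if "i \<in> {1..n}" "j \<in> {1..n}" "i \<noteq> j" for i j
    using assms(3) that by blast
  ultimately obtain v where v: "bij_betw v {1..n} {1..n}"
    and edge: "\<And>i. \<lbrakk>1 \<le> i; i < n\<rbrakk> \<Longrightarrow> rs (v i) (v (Suc i)) \<noteq> 0"
    and edges: "\<And>i j. \<lbrakk>1 \<le> i; i < j; j \<le> n; rs (v i) (v j) \<noteq> 0\<rbrakk>
      \<Longrightarrow> j = Suc i \<or> i = 1 \<and> j = n \<and> qs (v n) (v 1) = q"
    and qs: "\<And>i j. \<lbrakk>1 \<le> i; i < j; j \<le> n\<rbrakk>
      \<Longrightarrow> qs (v i) (v j) = (if odd (j - i) then q else inverse q)"
    using enumeration[OF assms(2)] by blast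
  have "1 - q \<noteq> 0"
    using assms(4) by simp
  define y where "y c i = scale (c i) (x (v i))" for c i
  have v_in: "v i \<in> {1..n}" if "i \<in> {1..n}" for i
    using bij_betw_apply[OF v that] .
  have v_neq: "v i \<noteq> v j" if "i \<in> {1..n}" "j \<in> {1..n}" "i \<noteq> j" for i j
    using inj_onD[OF bij_betw_imp_inj_on[OF v]] that by blast
  \<comment> \<open>Rescaling leaves \<open>qs\<close> unchanged and multiplies the constant term by
    \<open>c i * c j\<close>.\<close>
  have y_rel: "y c i * y c j - scale (qs (v i) (v j)) (y c j * y c i) =
      scale (c i * c j * rs (v i) (v j)) 1" if "i \<in> {1..n}" "j \<in> {1..n}" "i \<noteq> j" for c i j
    using relations[OF v_in[OF that(1)] v_in[OF that(2)] v_neq[OF that]]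
    by (simp add: y_def scale_mult_left scale_mult_right scale_right_distrib mult_ac)
  have neighbours: "y c i * y c (i + 1) - scale q (y c (i + 1) * y c i) - scale (1 - q) 1 = 0"
    if "1 \<le> i" "i + 1 \<le> n" "c i * c (Suc i) * rs (v i) (v (Suc i)) = 1 - q" for c i
    using y_rel[of i "i + 1" c] qs[of i "i + 1"] that by simp
  have far: "y c i * y c j - scale (if odd (j - i) then q else inverse q) (y c j * y c i) = 0"
    if "1 \<le> i" "i + 1 < j" "j \<le> n" "rs (v i) (v j) = 0" for c i j
    using y_rel[of i j c] qs[of i j] that by simp
  show ?thesis
  \<comment> \<open>For \<open>n = 2\<close> the pair \<open>(1, n)\<close> is the path edge itself
    rather than a closing edge, so this case belongs to the path.\<close>
  proof (cases "n \<noteq> 2 \<and> rs (v 1) (v n) \<noteq> 0")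
    case False
    obtain c where c: "\<And>i. c i \<noteq> 0"
      "\<And>i. rs (v i) (v (Suc i)) \<noteq> 0 \<Longrightarrow> c i * c (Suc i) * rs (v i) (v (Suc i)) = 1 - q"
      using path_scalars[OF \<open>1 - q \<noteq> 0\<close>, of "\<lambda>i. rs (v i) (v (Suc i))"] by blast
    have no_edge: "rs (v i) (v j) = 0" if "1 \<le> i" "i + 1 < j" "j \<le> n" for i j
      using edges[of i j] that False by auto
    have vanish: "evaluate (y c) s = 0" if "s \<in> L_relators n q" for s
      using that unfolding L_relators_def
    proof (elim UnE CollectE exE conjE)
      fix i assume "s = var i * var (i + 1) - const q * (var (i + 1) * var i) - const (1 - q)"
        "1 \<le> i" "i + 1 \<le> n"
      then show ?thesis
        using neighbours[of i c] c edge[of i]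
        by (simp add: evaluate_diff[of _ _ "const _"] evaluate_exchange evaluate_const)
    next
      fix i j assume "s = var i * var j - const q * (var j * var i)"
        "1 \<le> i" "i + 1 < j" "j \<le> n" "odd (j - i)"
      then show ?thesis
        using far[of i j c] no_edge[of i j] by (simp add: evaluate_exchange)
    next
      fix i j assume "s = var i * var j - const (inverse q) * (var j * var i)"
        "1 \<le> i" "i + 1 < j" "j \<le> n" "even (j - i)"
      then show ?thesis
        using far[of i j c] no_edge[of i j] by (simp add: evaluate_exchange)
    qed
    have "algebra_of_type scale \<simeq>\<^sub>a\<^sub>l\<^sub>g presented_algebra {1..n} (L_relators n q)"
    proof (rule isomorphic_presented_algebra[OF v c(1)])
      show "L_relators n q \<subseteq> carrier (free_algebra {1..n})"
        by (rule L_relators_carrier)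
      show "evaluate (\<lambda>i. scale (c i) (x (v i))) s = 0" if "s \<in> L_relators n q" for s
        using vanish[OF that] by (simp only: y_def[abs_def])
      show "\<exists>a b. a \<noteq> 0 \<and> (var i * var j - const a * (var j * var i) - const b \<in> L_relators n q \<or>
          var j * var i - const a * (var i * var j) - const b \<in> L_relators n q)"
        if "1 \<le> i" "i < j" "j \<le> n" for i j
        using L_relators_exchange[OF assms(2) that] by blast
    qed
    then show ?thesis
      by (simp add: L_algebra_def)
  next
    case True
    then have n: "2 < n"
      using n_ge_2 by simp
    \<comment> \<open>As \<open>n > 2\<close>, the edge between \<open>v 1\<close> and
      \<open>v n\<close> is not a step of the path, so it is the closing arrow.\<close>
    then have qs_n_1: "qs (v n) (v 1) = q"
      using edges[of 1 n] True by simp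
    then have "qs (v 1) (v n) = inverse q"
      using q_swap[of "v n" "v 1"] v_in[of 1] v_in[of n] v_neq[of n 1] n by simp
    \<comment> \<open>Alternation along the path would give \<open>q\<close> for odd
      \<open>n - 1\<close>, whereas the closing arrow gives \<open>inverse q\<close>.\<close>
    then have "even (n - 1)"
      using qs[of 1 n] n \<open>q \<noteq> inverse q\<close> by (metis one_less_numeral_iff order.strict_trans order_refl semiring_norm(76))
    then have "odd n"
      using n by simp
    \<comment> \<open>The closing relator runs from \<open>n\<close> to 1, so its constant is needed
      in this orientation.\<close>
    have "rs (v n) (v 1) \<noteq> 0"
      using True r_swap[of "v 1" "v n"] q_nonzero[of "v 1" "v n"] v_in[of 1] v_in[of n] v_neq[of 1 n] n
      by simp
    then obtain c where c: "\<And>i. c i \<noteq> 0"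
      "\<And>i. rs (v i) (v (Suc i)) \<noteq> 0 \<Longrightarrow> c i * c (Suc i) * rs (v i) (v (Suc i)) = 1 - q"
      "c n * c 1 * rs (v n) (v 1) = 1 - q"
      using cycle_scalars[OF \<open>1 - q \<noteq> 0\<close> \<open>odd n\<close>, of "rs (v n) (v 1)" "\<lambda>i. rs (v i) (v (Suc i))"] by blast
    have no_edge: "rs (v i) (v j) = 0" if "1 \<le> i" "i + 1 < j" "j \<le> n" "(i, j) \<noteq> (1, n)" for i j
      using edges[of i j] that by auto
    have vanish: "evaluate (y c) s = 0" if "s \<in> C_relators n q" for s
      using that unfolding C_relators_def
    proof (elim UnE CollectE exE conjE)
      fix i assume "s = var i * var (i + 1) - const q * (var (i + 1) * var i) - const (1 - q)"
        "1 \<le> i" "i + 1 \<le> n"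
      then show ?thesis
        using neighbours[of i c] c edge[of i]
        by (simp add: evaluate_diff[of _ _ "const _"] evaluate_exchange evaluate_const)
    next
      assume "s \<in> {var n * var 1 - const q * (var 1 * var n) - const (1 - q)}"
      then show ?thesis
        using y_rel[of n 1 c] qs_n_1 c(3) n
        by (simp add: evaluate_diff[of _ _ "const _"] evaluate_exchange evaluate_const)
    next
      fix i j assume ij: "s = var i * var j - const q * (var j * var i)"
        "1 \<le> i" "i + 1 < j" "j \<le> n" "odd (j - i)"
      \<comment> \<open>The closing pair has even difference, so it is not among these pairs of odd
        difference.\<close>
      then have "(i, j) \<noteq> (1, n)"
        using \<open>even (n - 1)\<close> by auto
      then show ?thesis
        using ij far[of i j c] no_edge[of i j] by (simp add: evaluate_exchange)
    next
      fix i j assume "s = var i * var j - const (inverse q) * (var j * var i)"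
        "1 \<le> i" "i + 1 < j" "j \<le> n" "even (j - i)" "(i, j) \<noteq> (1, n)"
      then show ?thesis
        using far[of i j c] no_edge[of i j] by (simp add: evaluate_exchange)
    qed
    have "algebra_of_type scale \<simeq>\<^sub>a\<^sub>l\<^sub>g presented_algebra {1..n} (C_relators n q)"
    proof (rule isomorphic_presented_algebra[OF v c(1)])
      show "C_relators n q \<subseteq> carrier (free_algebra {1..n})"
        using n_ge_2 by (intro C_relators_carrier) simp
      show "evaluate (\<lambda>i. scale (c i) (x (v i))) s = 0" if "s \<in> C_relators n q" for s
        using vanish[OF that] by (simp only: y_def[abs_def])
      show "\<exists>a b. a \<noteq> 0 \<and> (var i * var j - const a * (var j * var i) - const b \<in> C_relators n q \<or>
          var j * var i - const a * (var i * var j) - const b \<in> C_relators n q)"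
        if "1 \<le> i" "i < j" "j \<le> n" for i j
        using C_relators_exchange[OF assms(2) that] by blast
    qed
    with \<open>odd n\<close> show ?thesis
      by (simp add: C_algebra_def)
  qed
qed

end
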